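(* Let $0<\epsilon\le 1/2$, $0<\epsilon'<1/2$, $\alpha>0$, $\gamma>0$ and $k\ge1$, with $h(\epsilon')\le4\epsilon(1-\epsilon)\alpha$. Let \[\nu=\alpha\cdot\frac{\big[\sqrt{1-h(\epsilon')/\alpha}-(1-2\epsilon)\big]^2}{4\epsilon(1-\epsilon)}.\] Then there is no non-interactive protocol (with any number of samples) solving CorrelatedRandomness$_{\gamma,\epsilon',\alpha,k}$ for the source $\mathsf{DSBS}(1-2\epsilon)$ with $\gamma>2^{-\nu k}$. Consequently, whenever $h(\epsilon')\le4\epsilon(1-\epsilon)\alpha/(1+\Omega(1))$, there is no non-interactive protocol solving CorrelatedRandomness$_{\gamma,\epsilon',\alpha,k}$ given i.i.d. access to $\mathsf{DSBS}(1-2\epsilon)$ with $\gamma>2^{-\Omega(\epsilon\alpha k)}$.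
   Context: $h$ is the binary entropy function. $(X,Y)\sim\mathsf{DSBS}(\rho)$ means $X,Y$ uniform on $\{\pm1\}$ with $\mathbb E[XY]=\rho$. In the CorrelatedRandomness$_{\gamma,\epsilon',\alpha,k}$ problem, Alice and Bob get $X^n$ and $Y^n$, where $(X_i,Y_i)$ are i.i.d. samples from the source; Alice outputs $w_A\in\{0,1\}^k$ and Bob outputs $w_B\in\{0,1\}^k$ such that (i) $\Pr[\Delta(w_A,w_B)\le\epsilon'k]\ge\gamma$, where $\Delta$ is Hamming distance; (ii) $H_\infty(w_A)\ge\alpha k$; (iii) $H_\infty(w_B)\ge\alpha k$, where $H_\infty$ is min-entropy. In a non-interactive protocol no communication occurs: $w_A$ is a function of Alice's samples and $w_B$ a function of Bob's samples. *)

theory Defs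
  imports "HOL-Probability.Probability"
begin

definition binary_entropy :: "real \<Rightarrow> real" where
  "binary_entropy x = - x * log 2 x - (1 - x) * log 2 (1 - x)"

definition min_entropy :: "'a pmf \<Rightarrow> real" where
  "min_entropy p = - log 2 (SUP x. pmf p x)"

text \<open>Only meaningful for lists of equal length, which is the only case in which it is used.\<close>

definition hamming_dist :: "'a list \<Rightarrow> 'a list \<Rightarrow> nat" where
  "hamming_dist u v = card {i. i < length u \<and> u ! i \<noteq> v ! i}"

text \<open>
  The conditions determine \<^term>\<open>\<mu>\<close> uniquely, and are satisfiable exactly when
  \<^prop>\<open>\<bar>\<rho>\<bar> \<le> 1\<close>; satisfiability is proved below.
\<close>

definition is_DSBS :: "real \<Rightarrow> (real \<times> real) pmf \<Rightarrow> bool" where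
  "is_DSBS \<rho> \<mu> \<longleftrightarrow>
     map_pmf fst \<mu> = pmf_of_set {-1, 1} \<and>
     map_pmf snd \<mu> = pmf_of_set {-1, 1} \<and>
     measure_pmf.expectation \<mu> (\<lambda>(x, y). x * y) = \<rho>"

lemma is_DSBS_exists:
  assumes "-1 \<le> \<rho>" "\<rho> \<le> 1"
  shows "\<exists>\<mu>. is_DSBS \<rho> \<mu>"
proof -
  define U where "U = pmf_of_set {-1, 1 :: real}"
  define B where "B = bernoulli_pmf ((1 + \<rho>) / 2)"
  define \<mu> where "\<mu> = map_pmf (\<lambda>(b, x). (x, if b then x else - x)) (pair_pmf B U)"
  have neg: "map_pmf uminus U = U"
    unfolding U_def by (subst map_pmf_of_set_inj) (auto simp: insert_commute)
  have "map_pmf fst \<mu> = map_pmf snd (pair_pmf B U)"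
    by (simp add: \<mu>_def pmf.map_comp o_def case_prod_unfold)
  then have 1: "map_pmf fst \<mu> = U"
    by (simp add: map_snd_pair_pmf)
  have "map_pmf snd \<mu> = bind_pmf B (\<lambda>b. map_pmf (\<lambda>x. if b then x else - x) U)"
    by (simp add: \<mu>_def pair_pmf_def map_bind_pmf bind_map_pmf map_pmf_def bind_assoc_pmf bind_return_pmf)
  also have "\<dots> = bind_pmf B (\<lambda>b. U)"
  proof (intro bind_pmf_cong refl)
    fix b
    show "map_pmf (\<lambda>x. if b then x else - x) U = U"
      using neg by (cases b) simp_all
  qed
  finally have 2: "map_pmf snd \<mu> = U" by simp
  have "measure_pmf.expectation \<mu> (\<lambda>(x, y). x * y)
      = measure_pmf.expectation (pair_pmf B U) (\<lambda>(b, x). x * (if b then x else - x))"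
    by (simp add: \<mu>_def case_prod_unfold)
  also have "\<dots> = measure_pmf.expectation (pair_pmf B U) (\<lambda>z. if fst z then 1 else - 1)"
    by (intro integral_cong_AE) (auto simp: AE_measure_pmf_iff U_def)
  also have "\<dots> = measure_pmf.expectation (map_pmf fst (pair_pmf B U)) (\<lambda>b. if b then 1 else - 1)"
    by simp
  also have "\<dots> = measure_pmf.expectation B (\<lambda>b. if b then 1 else - 1)"
    by (simp only: map_fst_pair_pmf)
  also have "\<dots> = \<rho>"
    using assms by (simp add: B_def field_simps)
  finally show ?thesis
    using 1 2 unfolding is_DSBS_def U_def by blast
qed

text \<open>\<^term>\<open>W\<close> is the joint law of the outputs of Alice and Bob.\<close>

definition correlated_randomness ::
  "real \<Rightarrow> real \<Rightarrow> real \<Rightarrow> nat \<Rightarrow> (bool list \<times> bool list) pmf \<Rightarrow> bool" where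
  "correlated_randomness \<gamma> \<epsilon>' \<alpha> k W \<longleftrightarrow>
     (\<forall>(a, b)\<in>set_pmf W. length a = k \<and> length b = k) \<and>
     measure_pmf.prob W {(a, b). real (hamming_dist a b) \<le> \<epsilon>' * real k} \<ge> \<gamma> \<and>
     min_entropy (map_pmf fst W) \<ge> \<alpha> * real k \<and>
     min_entropy (map_pmf snd W) \<ge> \<alpha> * real k"

definition noninteractive_output ::
  "('a \<times> 'b) pmf \<Rightarrow> nat \<Rightarrow> ('a list \<Rightarrow> 'c) \<Rightarrow> ('b list \<Rightarrow> 'd) \<Rightarrow> ('c \<times> 'd) pmf" where
  "noninteractive_output \<mu> n f g =
     map_pmf (\<lambda>zs. (f (map fst zs), g (map snd zs))) (replicate_pmf n \<mu>)"

definition noninteractively_solvable ::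
  "('a \<times> 'b) pmf \<Rightarrow> real \<Rightarrow> real \<Rightarrow> real \<Rightarrow> nat \<Rightarrow> bool" where
  "noninteractively_solvable \<mu> \<gamma> \<epsilon>' \<alpha> k \<longleftrightarrow>
     (\<exists>n f g. correlated_randomness \<gamma> \<epsilon>' \<alpha> k (noninteractive_output \<mu> n f g))"

definition nu :: "real \<Rightarrow> real \<Rightarrow> real \<Rightarrow> real" where
  "nu \<epsilon> \<epsilon>' \<alpha> =
     \<alpha> * ((sqrt (1 - binary_entropy \<epsilon>' / \<alpha>) - (1 - 2 * \<epsilon>))\<^sup>2 / (4 * \<epsilon> * (1 - \<epsilon>)))"

end

theory Submission
  imports Defs
begin

text \<open>
  Write \<open>\<rho> = 1 - 2\<epsilon>\<close> and \<open>\<beta> = sqrt (1 - h(\<epsilon>')/\<alpha>)\<close>.  The source satisfies the two-function hypercontractive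
  inequality \<open>E[f(X) g(Y)] \<le> \<parallel>f\<parallel>\<^sub>p \<parallel>g\<parallel>\<^sub>q\<close> whenever \<open>(p - 1)(q - 1) = \<rho>\<^sup>2\<close>, and this inequality
  tensorises.  Put \<open>s = 1/p\<close>, \<open>t = 1/q\<close>.  Applied to the indicators of
  \<open>w\<^sub>A = a\<close> and of \<open>w\<^sub>B\<close> lying in the Hamming ball \<open>B(a)\<close> of radius \<open>\<epsilon>'k\<close>, it bounds the agreement
  probability by the sum over \<open>a\<close> of \<open>Pr[w\<^sub>A = a]\<^sup>s Pr[w\<^sub>B \<in> B(a)]\<^sup>t\<close>.  With \<open>P = 2\<close> to the power \<open>-\<alpha>k\<close> bounding
  the point probabilities and \<open>V = 2\<close> to the power \<open>h(\<epsilon>')k\<close> bounding the ball sizes, Hoelder's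
  inequality bounds that sum by \<open>V\<close> to the power \<open>t\<close> times \<open>P\<close> to the power \<open>s + t - 1\<close>.  Minimising over the
  admissible pairs \<open>(s, t)\<close> gives \<open>s = (1 - \<rho>\<beta>)/(1 - \<rho>\<^sup>2)\<close>, \<open>t = (1 - \<rho>/\<beta>)/(1 - \<rho>\<^sup>2)\<close> and exactly the
  exponent \<open>-\<nu>k\<close>.
\<close>

subsection \<open>Two-point hypercontractivity\<close>

text \<open>All factors \<open>a - i\<close> except the first two have their sign flipped; their
  number is even, so the product is unchanged. For \<open>a \<le> 2\<close> every flipped factor is
  nonnegative.\<close>

lemma gbinomial_even_eq:
  fixes a :: real
  shows "a gchoose (2 * m + 2) = a * (a - 1) * (\<Prod>j<2 * m. real j + 2 - a) / fact (2 * m + 2)"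
proof -
  have "(\<Prod>i<2 * m + 2. a - real i) = a * (a - 1) * (\<Prod>j<2 * m. a - real (Suc (Suc j)))"
    by (simp add: prod.lessThan_Suc_shift o_def del: prod.lessThan_Suc)
  also have "(\<Prod>j<2 * m. a - real (Suc (Suc j))) = (\<Prod>j<2 * m. - 1 * (real j + 2 - a))"
    by (intro prod.cong) auto
  also have "\<dots> = (\<Prod>j<2 * m. real j + 2 - a)"
    by (subst prod.distrib) simp
  finally show ?thesis
    by (simp add: gbinomial_prod_rev atLeast0LessThan)
qed

text \<open>In the product form, \<open>p / r\<close> turns the leading \<open>r * (r - 1)\<close>
  into \<open>p * (r - 1)\<close>. As \<open>\<rho> \<le> 1\<close>, the power of
  \<open>\<rho>\<close> lowers \<open>r - 1\<close> to at most \<open>p - 1\<close>, and the other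
  factors \<open>j + 2 - a\<close> grow when \<open>a\<close> falls from \<open>r\<close> to
  \<open>p\<close>.\<close>

lemma gbinomial_even_le:
  fixes p r \<rho> :: real
  assumes "1 < p" "p \<le> r" "r \<le> 2" "0 \<le> \<rho>" "\<rho>\<^sup>2 * (r - 1) \<le> p - 1"
  shows "p / r * (r gchoose (2 * m + 2)) * \<rho> ^ (2 * m + 2) \<le> p gchoose (2 * m + 2)"
proof -
  define E where "E a = (\<Prod>j<2 * m. real j + 2 - a)" for a :: real
  have "\<rho>\<^sup>2 * (r - 1) \<le> 1 * (r - 1)" using assms unfolding mult_1 by linarith
  then have "\<rho>\<^sup>2 \<le> 1" by (rule mult_right_le_imp_le) (use assms in simp)
  then have "\<rho> ^ (2 * m) \<le> 1" by (simp add: power_mult power_le_one)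
  then have "\<rho> ^ (2 * m) * (\<rho>\<^sup>2 * (r - 1)) \<le> 1 * (p - 1)"
    using assms by (intro mult_mono) auto
  then have rho: "\<rho> ^ (2 * m + 2) * (r - 1) \<le> p - 1"
    by (simp add: power_add mult_ac power2_eq_square)
  have E: "0 \<le> E r" "E r \<le> E p"
    unfolding E_def using assms by (auto intro!: prod_nonneg prod_mono)
  have "p / r * (r gchoose (2 * m + 2)) * \<rho> ^ (2 * m + 2)
      = p * ((\<rho> ^ (2 * m + 2) * (r - 1)) * E r) / fact (2 * m + 2)"
    using assms unfolding gbinomial_even_eq E_def[symmetric] by (simp add: mult_ac del: fact_Suc power_Suc)
  also have "\<dots> \<le> p * ((p - 1) * E p) / fact (2 * m + 2)"
    using assms rho E by (intro divide_right_mono mult_left_mono mult_mono) auto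
  also have "\<dots> = p gchoose (2 * m + 2)"
    unfolding gbinomial_even_eq E_def[symmetric] by simp
  finally show ?thesis .
qed

text \<open>Young's inequality, extended to zero arguments: there the left side is 0, because
  \<open>0 powr x = 0\<close> for every \<open>x\<close>.\<close>

lemma weighted_am_gm:
  fixes a b s :: real
  assumes "0 \<le> s" "s \<le> 1" "0 \<le> a" "0 \<le> b"
  shows "a powr s * b powr (1 - s) \<le> s * a + (1 - s) * b"
  using Youngs_inequality_0[of s "1 - s" a b] assms
  by (cases "a = 0 \<or> b = 0") auto

text \<open>A function of mean 1 on two points has values \<open>1 + z\<close> and
  \<open>1 - z\<close>, and noise replaces \<open>z\<close> by \<open>\<rho> * z\<close>; this is
  the \<open>p\<close>-th power of the norm inequality. Strictness of
  \<open>\<bar>z\<bar> < 1\<close> makes the binomial series converge.\<close>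

lemma two_point_hypercontractive_open:
  fixes p r \<rho> z :: real
  assumes "1 < p" "p \<le> r" "r \<le> 2" "0 \<le> \<rho>" "\<rho> \<le> 1" "\<rho>\<^sup>2 * (r - 1) \<le> p - 1" "\<bar>z\<bar> < 1"
  shows "(((1 + \<rho> * z) powr r + (1 - \<rho> * z) powr r) / 2) powr (p / r)
          \<le> ((1 + z) powr p + (1 - z) powr p) / 2"
proof -
  define S where "S = ((1 + \<rho> * z) powr r + (1 - \<rho> * z) powr r) / 2"
  have "\<bar>\<rho> * z\<bar> \<le> \<bar>z\<bar>" using assms by (simp add: abs_mult mult_left_le_one_le)
  then have rz: "\<bar>\<rho> * z\<bar> < 1" using assms by linarith
  have ser: "(\<lambda>n. (a gchoose n) * (x ^ n + (- x) ^ n) / 2)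
                sums (((1 + x) powr a + (1 - x) powr a) / 2)" if "\<bar>x\<bar> < 1" for a x :: real
    using sums_divide[OF sums_add[OF gen_binomial_real[of x a] gen_binomial_real[of "- x" a]], of 2] that
    by (simp add: algebra_simps)
  txt \<open>Linearise the outer power; the two series then compare term by term.\<close>
  have "S powr (p / r) * 1 powr (1 - p / r) \<le> p / r * S + (1 - p / r) * 1"
    using assms by (intro weighted_am_gm) (auto simp: S_def)
  also have "\<dots> \<le> ((1 + z) powr p + (1 - z) powr p) / 2"
  proof (rule sums_le)
    show "(\<lambda>n. p / r * ((r gchoose n) * ((\<rho> * z) ^ n + (- (\<rho> * z)) ^ n) / 2)
               + (if n = 0 then 1 - p / r else 0)) sums (p / r * S + (1 - p / r) * 1)"
      using sums_add[OF sums_mult[OF ser[OF rz], of "p / r" r] sums_single[of 0 "\<lambda>_. 1 - p / r"]]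
      by (simp add: S_def)
    show "(\<lambda>n. (p gchoose n) * (z ^ n + (- z) ^ n) / 2) sums (((1 + z) powr p + (1 - z) powr p) / 2)"
      using ser assms by blast
    fix n :: nat
    consider "n = 0" | "odd n" | m where "n = 2 * m + 2"
    proof (cases "n = 0 \<or> odd n")
      case False
      then obtain l where "n = 2 * l" "l \<noteq> 0" by (auto elim: evenE)
      then have "n = 2 * (l - 1) + 2" by simp
      then show ?thesis using that by blast
    qed (use that in auto)
    \<comment> \<open>Both constant terms are 1 and the odd terms cancel, so only even
      \<open>n \<ge> 2\<close> call for \<open>gbinomial_even_le\<close>.\<close>
    then show "p / r * ((r gchoose n) * ((\<rho> * z) ^ n + (- (\<rho> * z)) ^ n) / 2)
               + (if n = 0 then 1 - p / r else 0) \<le> (p gchoose n) * (z ^ n + (- z) ^ n) / 2"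
    proof cases
      case 3
      then have "even n" by simp
      have "(p / r * (r gchoose n) * \<rho> ^ n) * z ^ n \<le> (p gchoose n) * z ^ n"
        unfolding 3 using assms by (intro mult_right_mono gbinomial_even_le zero_le_even_power) auto
      then show ?thesis using \<open>even n\<close> 3 by (simp add: power_mult_distrib mult_ac)
    qed auto
  qed
  finally show ?thesis by (simp add: S_def)
qed

text \<open>The endpoints follow by continuity along points \<open>c n\<close> strictly inside the
  interval; the exponents are positive, so \<open>powr\<close> stays continuous where a base
  vanishes.\<close>

lemma two_point_hypercontractive_closed:
  fixes p r \<rho> z :: real
  assumes "1 < p" "p \<le> r" "r \<le> 2" "0 \<le> \<rho>" "\<rho> \<le> 1" "\<rho>\<^sup>2 * (r - 1) \<le> p - 1" "\<bar>z\<bar> \<le> 1"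
  shows "(((1 + \<rho> * z) powr r + (1 - \<rho> * z) powr r) / 2) powr (p / r)
          \<le> ((1 + z) powr p + (1 - z) powr p) / 2"
proof (rule LIMSEQ_le)
  define c where "c n = z * (1 - inverse (real (Suc n)))" for n
  have "c \<longlonglongrightarrow> z * (1 - 0)"
    unfolding c_def by (intro tendsto_intros LIMSEQ_inverse_real_of_nat)
  then have c: "c \<longlonglongrightarrow> z" by simp
  have "\<bar>c n\<bar> < 1" for n
  proof -
    have "\<bar>c n\<bar> \<le> 1 * \<bar>1 - inverse (real (Suc n))\<bar>"
      unfolding c_def abs_mult using assms by (intro mult_right_mono) auto
    also have "\<dots> < 1" by (auto simp: field_simps)
    finally show ?thesis .
  qed
  note lt = this
  have le: "\<bar>\<rho> * x\<bar> \<le> 1" if "\<bar>x\<bar> \<le> 1" for x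
    using assms that by (simp add: abs_mult mult_le_one)
  have le': "0 \<le> 1 + \<rho> * c n" "0 \<le> 1 - \<rho> * c n" "0 \<le> 1 + c n" "0 \<le> 1 - c n" for n
    using le[of "c n"] lt[of n] by auto
  show "\<exists>N. \<forall>n\<ge>N. (((1 + \<rho> * c n) powr r + (1 - \<rho> * c n) powr r) / 2) powr (p / r)
          \<le> ((1 + c n) powr p + (1 - c n) powr p) / 2"
    using two_point_hypercontractive_open[OF assms(1-6) lt] by blast
  show "(\<lambda>n. (((1 + \<rho> * c n) powr r + (1 - \<rho> * c n) powr r) / 2) powr (p / r))
          \<longlonglongrightarrow> (((1 + \<rho> * z) powr r + (1 - \<rho> * z) powr r) / 2) powr (p / r)"
    using assms le' by (intro tendsto_powr' tendsto_intros c) (auto intro!: always_eventually)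
  show "(\<lambda>n. ((1 + c n) powr p + (1 - c n) powr p) / 2)
          \<longlonglongrightarrow> ((1 + z) powr p + (1 - z) powr p) / 2"
    using assms le' by (intro tendsto_powr' tendsto_intros c) (auto intro!: always_eventually)
qed

text \<open>
  A function on \<open>{-1, 1}\<close> is given by its two values; \<open>bit_noise \<rho> a b\<close> is the value of
  \<open>T\<^sub>\<rho> f\<close> at the point where \<open>f\<close> has value \<open>a\<close>, the other value being \<open>b\<close>.
\<close>

definition bit_noise :: "real \<Rightarrow> real \<Rightarrow> real \<Rightarrow> real" where
  "bit_noise \<rho> a b = (1 + \<rho>) / 2 * a + (1 - \<rho>) / 2 * b"

definition bit_norm :: "real \<Rightarrow> real \<Rightarrow> real \<Rightarrow> real" where
  "bit_norm p a b = ((a powr p + b powr p) / 2) powr (1 / p)"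

lemma bit_noise_nonneg:
  "\<bar>\<rho>\<bar> \<le> 1 \<Longrightarrow> 0 \<le> a \<Longrightarrow> 0 \<le> b \<Longrightarrow> 0 \<le> bit_noise \<rho> a b"
  by (simp add: bit_noise_def)

lemma bit_norm_nonneg: "0 \<le> bit_norm p a b"
  by (simp add: bit_norm_def)

text \<open>Both sides are homogeneous and noise preserves the mean \<open>m\<close>, so a nonzero
  function reduces to the mean-one case with values \<open>1 + z\<close> and
  \<open>1 - z\<close>.\<close>

lemma two_point_hypercontractive:
  fixes p r \<rho> a b :: real
  assumes "1 < p" "p \<le> r" "r \<le> 2" "0 \<le> \<rho>" "\<rho> \<le> 1" "\<rho>\<^sup>2 * (r - 1) \<le> p - 1" "0 \<le> a" "0 \<le> b"
  shows "bit_norm r (bit_noise \<rho> a b) (bit_noise \<rho> b a) \<le> bit_norm p a b"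
proof (cases "a + b = 0")
  case True
  then have "a = 0" "b = 0" using assms by auto
  then show ?thesis by (simp add: bit_norm_def bit_noise_def)
next
  case False
  define m z where "m = (a + b) / 2" and "z = (a - b) / (a + b)"
  have m: "0 < m" using False assms by (simp add: m_def)
  have z: "\<bar>z\<bar> \<le> 1" using False assms by (auto simp: z_def abs_le_iff field_simps)
  have "\<bar>\<rho> * z\<bar> \<le> 1" using assms z by (simp add: abs_mult mult_le_one)
  then have nn: "0 \<le> 1 + \<rho> * z" "0 \<le> 1 - \<rho> * z" "0 \<le> 1 + z" "0 \<le> 1 - z" using z by auto
  have eq: "a = m * (1 + z)" "b = m * (1 - z)"
    using False by (simp_all add: m_def z_def field_simps)
  have eq': "bit_noise \<rho> a b = m * (1 + \<rho> * z)" "bit_noise \<rho> b a = m * (1 - \<rho> * z)"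
    unfolding eq bit_noise_def by (simp_all add: field_simps)
  have hom: "bit_norm q (m * x) (m * y) = m * bit_norm q x y" if "0 < q" "0 \<le> x" "0 \<le> y" for q x y
  proof -
    have "bit_norm q (m * x) (m * y) = (m powr q * ((x powr q + y powr q) / 2)) powr (1 / q)"
      using that m by (simp add: bit_norm_def powr_mult algebra_simps)
    also have "\<dots> = m * bit_norm q x y"
      using that m unfolding bit_norm_def by (subst powr_mult) (auto simp: powr_powr)
    finally show ?thesis .
  qed
  have "((((1 + \<rho> * z) powr r + (1 - \<rho> * z) powr r) / 2) powr (p / r)) powr (1 / p)
          \<le> (((1 + z) powr p + (1 - z) powr p) / 2) powr (1 / p)"
    using assms by (intro powr_mono2 two_point_hypercontractive_closed z) auto
  then have "bit_norm r (1 + \<rho> * z) (1 - \<rho> * z) \<le> bit_norm p (1 + z) (1 - z)"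
    using assms by (simp add: bit_norm_def powr_powr)
  then have "m * bit_norm r (1 + \<rho> * z) (1 - \<rho> * z) \<le> m * bit_norm p (1 + z) (1 - z)"
    using m by simp
  also have "\<dots> = bit_norm p a b"
    unfolding eq using assms nn by (subst hom) auto
  also have "m * bit_norm r (1 + \<rho> * z) (1 - \<rho> * z) = bit_norm r (bit_noise \<rho> a b) (bit_noise \<rho> b a)"
    unfolding eq' using assms nn by (subst hom) auto
  finally show ?thesis .
qed

section \<open>Hoelder's inequality and the two-function form\<close>

text \<open>Divide each function by its norm, apply Young's inequality at both points and average:
  the result is \<open>1 / p + 1 / q = 1\<close>. A function of norm 0 vanishes.\<close>

lemma bit_norm_holder:
  fixes a b c d :: real
  assumes "1 < p" "1 < q" "1 / p + 1 / q = 1" "0 \<le> a" "0 \<le> b" "0 \<le> c" "0 \<le> d"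
  shows "(a * c + b * d) / 2 \<le> bit_norm p a b * bit_norm q c d"
proof (cases "bit_norm p a b = 0 \<or> bit_norm q c d = 0")
  case True
  then have "(a = 0 \<and> b = 0) \<or> (c = 0 \<and> d = 0)"
    using assms by (auto simp: bit_norm_def add_nonneg_eq_0_iff)
  then show ?thesis by (auto simp: bit_norm_nonneg)
next
  case False
  define A C where "A = bit_norm p a b" and "C = bit_norm q c d"
  have pos: "0 < A" "0 < C" using False bit_norm_nonneg[of p a b] bit_norm_nonneg[of q c d]
    by (auto simp: A_def C_def)
  have A: "A powr p = (a powr p + b powr p) / 2" "C powr q = (c powr q + d powr q) / 2"
    using assms by (auto simp: A_def C_def bit_norm_def powr_powr)
  have Y: "(x / A) * (y / C) \<le> (x powr p / A powr p) / p + (y powr q / C powr q) / q"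
    if "0 \<le> x" "0 \<le> y" for x y
    using Youngs_inequality[of p q "x / A" "y / C"] assms that pos by (simp add: powr_divide)
  have "(a * c + b * d) / 2 / (A * C) = ((a / A) * (c / C) + (b / A) * (d / C)) / 2"
    using pos by (simp add: field_simps)
  also have "\<dots> \<le> (((a powr p / A powr p) / p + (c powr q / C powr q) / q)
                 + ((b powr p / A powr p) / p + (d powr q / C powr q) / q)) / 2"
    using Y[of a c] Y[of b d] assms by (intro divide_right_mono add_mono) auto
  also have "\<dots> = ((a powr p + b powr p) / 2 / A powr p) / p + ((c powr q + d powr q) / 2 / C powr q) / q"
    by (simp add: add_divide_distrib)
  also have "\<dots> = 1"
    unfolding A[symmetric] using pos assms by simp
  finally show ?thesis using pos by (simp add: A_def C_def field_simps)
qed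

lemma two_point_two_function:
  fixes p q \<rho> a b c d :: real
  assumes "1 < p" "p \<le> 2" "1 < q" "0 \<le> \<rho>" "\<rho> \<le> 1" "(p - 1) * (q - 1) = \<rho>\<^sup>2"
    and nn: "0 \<le> a" "0 \<le> b" "0 \<le> c" "0 \<le> d"
  shows "(bit_noise \<rho> a b * c + bit_noise \<rho> b a * d) / 2 \<le> bit_norm p a b * bit_norm q c d"
proof (cases "q \<le> 2")
  case True
  txt \<open>Split the noise as \<open>\<rho> = \<rho>1 \<rho>2\<close>, one factor on each function, and use Cauchy-Schwarz.\<close>
  define \<rho>1 \<rho>2 where "\<rho>1 = sqrt (p - 1)" and "\<rho>2 = sqrt (q - 1)"
  have \<rho>: "\<rho>1 * \<rho>2 = \<rho>"
    using assms by (simp add: \<rho>1_def \<rho>2_def real_sqrt_mult[symmetric])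
  have bd: "0 \<le> \<rho>1" "\<rho>1 \<le> 1" "0 \<le> \<rho>2" "\<rho>2 \<le> 1" "\<rho>1\<^sup>2 = p - 1" "\<rho>2\<^sup>2 = q - 1"
    using assms True by (auto simp: \<rho>1_def \<rho>2_def)
  have "(bit_noise \<rho> a b * c + bit_noise \<rho> b a * d) / 2
      = (bit_noise \<rho>1 a b * bit_noise \<rho>2 c d + bit_noise \<rho>1 b a * bit_noise \<rho>2 d c) / 2"
    unfolding bit_noise_def \<rho>[symmetric] by (simp add: field_simps)
  also have "\<dots> \<le> bit_norm 2 (bit_noise \<rho>1 a b) (bit_noise \<rho>1 b a) * bit_norm 2 (bit_noise \<rho>2 c d) (bit_noise \<rho>2 d c)"
    using bd nn by (intro bit_norm_holder bit_noise_nonneg) auto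
  also have "\<dots> \<le> bit_norm p a b * bit_norm q c d"
    using assms True bd by (intro mult_mono two_point_hypercontractive bit_norm_nonneg) auto
  finally show ?thesis .
next
  case False
  \<comment> \<open>For \<open>q > 2\<close> all noise goes to the first function. The conjugate
    exponent \<open>r\<close> of \<open>q\<close> is below 2, and
    \<open>(p - 1) * (q - 1) = \<rho>\<^sup>2\<close> becomes
    \<open>\<rho>\<^sup>2 * (r - 1) = p - 1\<close>, the extreme case of the one-function
    inequality.\<close>
  define r where "r = q / (q - 1)"
  have r: "1 < r" "r \<le> 2" "1 / r + 1 / q = 1" "r - 1 = 1 / (q - 1)"
    using False by (auto simp: r_def field_simps)
  have pr: "\<rho>\<^sup>2 * (r - 1) = p - 1"
    using False unfolding r(4) assms(6)[symmetric] by simp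
  have "\<rho>\<^sup>2 * (r - 1) \<le> 1 * (r - 1)"
    using assms r by (intro mult_right_mono) (auto simp: power_le_one)
  then have "p \<le> r" using pr by simp
  have "(bit_noise \<rho> a b * c + bit_noise \<rho> b a * d) / 2
      \<le> bit_norm r (bit_noise \<rho> a b) (bit_noise \<rho> b a) * bit_norm q c d"
    using assms r by (intro bit_norm_holder bit_noise_nonneg) auto
  also have "\<dots> \<le> bit_norm p a b * bit_norm q c d"
    using assms r pr \<open>p \<le> r\<close> by (intro mult_right_mono two_point_hypercontractive bit_norm_nonneg) auto
  finally show ?thesis .
qed

subsection \<open>Tensorisation\<close>

lemma is_DSBS_set_pmf:
  assumes "is_DSBS \<rho> \<mu>"
  shows "set_pmf \<mu> \<subseteq> {-1, 1} \<times> {-1, 1}"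
proof -
  have "fst ` set_pmf \<mu> = {-1, 1}" "snd ` set_pmf \<mu> = {-1, 1}"
    using assms unfolding is_DSBS_def
    by (metis set_map_pmf set_pmf_of_set finite.emptyI finite.insertI insert_not_empty)+
  then show ?thesis by (force simp: set_eq_iff)
qed

text \<open>The four point masses solve four linear equations: total mass 1, both means 0, and
  correlation \<open>\<rho>\<close>.\<close>

lemma is_DSBS_expectation:
  fixes \<phi> :: "real \<times> real \<Rightarrow> real"
  assumes "is_DSBS \<rho> \<mu>"
  shows "measure_pmf.expectation \<mu> \<phi>
       = (1 + \<rho>) / 4 * (\<phi> (1, 1) + \<phi> (-1, -1)) + (1 - \<rho>) / 4 * (\<phi> (1, -1) + \<phi> (-1, 1))"
proof -
  have sum4: "measure_pmf.expectation \<mu> \<psi> = \<psi> (1, 1) * pmf \<mu> (1, 1) + \<psi> (-1, -1) * pmf \<mu> (-1, -1)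
      + \<psi> (1, -1) * pmf \<mu> (1, -1) + \<psi> (-1, 1) * pmf \<mu> (-1, 1)" for \<psi> :: "real \<times> real \<Rightarrow> real"
    using is_DSBS_set_pmf[OF assms]
    by (subst integral_measure_pmf_real[where A = "{(1, 1), (-1, -1), (1, -1), (-1, 1)}"]) auto
  have "measure_pmf.expectation \<mu> fst = measure_pmf.expectation (map_pmf fst \<mu>) (\<lambda>x. x)"
    by simp
  also have "\<dots> = 0"
    using assms unfolding is_DSBS_def by (simp add: integral_pmf_of_set)
  finally have fst0: "measure_pmf.expectation \<mu> fst = 0" .
  have "measure_pmf.expectation \<mu> snd = measure_pmf.expectation (map_pmf snd \<mu>) (\<lambda>x. x)"
    by simp
  also have "\<dots> = 0"
    using assms unfolding is_DSBS_def by (simp add: integral_pmf_of_set)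
  finally have snd0: "measure_pmf.expectation \<mu> snd = 0" .
  have one: "measure_pmf.expectation \<mu> (\<lambda>_. 1) = (1 :: real)" by simp
  have prod: "measure_pmf.expectation \<mu> (\<lambda>(x, y). x * y) = \<rho>"
    using assms by (simp add: is_DSBS_def)
  have "pmf \<mu> (1, 1) = (1 + \<rho>) / 4" "pmf \<mu> (-1, -1) = (1 + \<rho>) / 4"
       "pmf \<mu> (1, -1) = (1 - \<rho>) / 4" "pmf \<mu> (-1, 1) = (1 - \<rho>) / 4"
    using fst0 snd0 one prod unfolding sum4 by auto
  note pmfs = this
  show ?thesis unfolding sum4 pmfs by (simp add: algebra_simps)
qed

text \<open>The parameters are the reciprocals \<open>s = 1/p\<close>, \<open>t = 1/q\<close> of the usual exponents.\<close>

definition hypercontractive :: "('a \<times> 'b) pmf \<Rightarrow> real \<Rightarrow> real \<Rightarrow> bool" where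
  "hypercontractive \<nu> s t \<longleftrightarrow>
     (\<forall>f g. (\<forall>x. 0 \<le> f x) \<longrightarrow> (\<forall>y. 0 \<le> g y) \<longrightarrow>
        measure_pmf.expectation \<nu> (\<lambda>(x, y). f x * g y)
          \<le> measure_pmf.expectation \<nu> (\<lambda>(x, y). f x powr (1 / s)) powr s
             * measure_pmf.expectation \<nu> (\<lambda>(x, y). g y powr (1 / t)) powr t)"

lemma hypercontractive_DSBS:
  assumes "is_DSBS \<rho> \<mu>" "0 \<le> \<rho>" "\<rho> \<le> 1" "1 < p" "p \<le> 2" "1 < q" "(p - 1) * (q - 1) = \<rho>\<^sup>2"
  shows "hypercontractive \<mu> (1 / p) (1 / q)"
  unfolding hypercontractive_def
proof (intro allI impI)
  fix f g :: "real \<Rightarrow> real"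
  assume "\<forall>x. 0 \<le> f x" "\<forall>y. 0 \<le> g y"
  then have le: "(bit_noise \<rho> (f 1) (f (-1)) * g 1 + bit_noise \<rho> (f (-1)) (f 1) * g (-1)) / 2
      \<le> bit_norm p (f 1) (f (-1)) * bit_norm q (g 1) (g (-1))"
    using assms by (intro two_point_two_function) auto
  have E: "measure_pmf.expectation \<mu> (\<lambda>(x, y). f x powr p) = (f 1 powr p + f (-1) powr p) / 2"
                "measure_pmf.expectation \<mu> (\<lambda>(x, y). g y powr q) = (g 1 powr q + g (-1) powr q) / 2"
                "measure_pmf.expectation \<mu> (\<lambda>(x, y). f x * g y)
                   = (bit_noise \<rho> (f 1) (f (-1)) * g 1 + bit_noise \<rho> (f (-1)) (f 1) * g (-1)) / 2"
    unfolding is_DSBS_expectation[OF assms(1)] bit_noise_def by (simp_all add: field_simps)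
  show "measure_pmf.expectation \<mu> (\<lambda>(x, y). f x * g y)
          \<le> measure_pmf.expectation \<mu> (\<lambda>(x, y). f x powr (1 / (1 / p))) powr (1 / p)
             * measure_pmf.expectation \<mu> (\<lambda>(x, y). g y powr (1 / (1 / q))) powr (1 / q)"
    using le by (simp add: E bit_norm_def del: divide_le_eq_numeral1)
qed

text \<open>At \<open>\<rho> = 0\<close> the two coordinates are independent, so equality holds
  already at the exponents \<open>p = q = 1\<close>.\<close>

lemma hypercontractive_DSBS_0:
  assumes "is_DSBS 0 \<mu>"
  shows "hypercontractive \<mu> 1 1"
  unfolding hypercontractive_def
proof (intro allI impI)
  fix f g :: "real \<Rightarrow> real"
  assume "\<forall>x. 0 \<le> f x" "\<forall>y. 0 \<le> g y"
  then show "measure_pmf.expectation \<mu> (\<lambda>(x, y). f x * g y)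
          \<le> measure_pmf.expectation \<mu> (\<lambda>(x, y). f x powr (1 / 1)) powr 1
             * measure_pmf.expectation \<mu> (\<lambda>(x, y). g y powr (1 / 1)) powr 1"
    unfolding is_DSBS_expectation[OF assms(1)]
    by (simp add: field_simps)
qed

section \<open>Independent samples and functions of them\<close>

lemma finite_set_replicate_pmf:
  assumes "finite (set_pmf \<mu>)"
  shows "finite (set_pmf (replicate_pmf n \<mu>))"
  using finite_lists_length_eq[OF assms, of n]
  by (simp add: set_replicate_pmf lists_eq_set)

lemma expectation_replicate_pmf_Suc:
  fixes h :: "'a list \<Rightarrow> real"
  assumes "finite (set_pmf \<mu>)"
  shows "measure_pmf.expectation (replicate_pmf (Suc n) \<mu>) h
       = measure_pmf.expectation \<mu> (\<lambda>z. measure_pmf.expectation (replicate_pmf n \<mu>) (\<lambda>zs. h (z # zs)))"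
proof -
  have "replicate_pmf (Suc n) \<mu> = bind_pmf \<mu> (\<lambda>z. map_pmf ((#) z) (replicate_pmf n \<mu>))"
    by (simp add: map_pmf_def)
  then have "measure_pmf.expectation (replicate_pmf (Suc n) \<mu>) h
     = (\<Sum>z\<in>set_pmf \<mu>. pmf \<mu> z *\<^sub>R measure_pmf.expectation (map_pmf ((#) z) (replicate_pmf n \<mu>)) h)"
    using assms by (simp only:) (intro pmf_expectation_bind, auto simp: finite_set_replicate_pmf)
  also have "\<dots> = measure_pmf.expectation \<mu> (\<lambda>z. measure_pmf.expectation (replicate_pmf n \<mu>) (\<lambda>zs. h (z # zs)))"
    using assms by (subst integral_measure_pmf_real[where A = "set_pmf \<mu>" and M = \<mu>]) (auto simp: mult.commute)
  finally show ?thesis .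
qed

text \<open>Induction on the number of samples: given the first pair, the induction hypothesis
  bounds the rest by a product of conditional norms, to which the one-sample inequality
  applies.\<close>

lemma hypercontractive_replicate:
  fixes f :: "'a list \<Rightarrow> real" and g :: "'b list \<Rightarrow> real"
  assumes \<mu>: "hypercontractive \<mu> s t" "finite (set_pmf \<mu>)" and st: "0 < s" "0 < t"
    and "\<And>xs. 0 \<le> f xs" "\<And>ys. 0 \<le> g ys"
  shows "measure_pmf.expectation (replicate_pmf n \<mu>) (\<lambda>zs. f (map fst zs) * g (map snd zs))
      \<le> measure_pmf.expectation (replicate_pmf n \<mu>) (\<lambda>zs. f (map fst zs) powr (1 / s)) powr s
         * measure_pmf.expectation (replicate_pmf n \<mu>) (\<lambda>zs. g (map snd zs) powr (1 / t)) powr t"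
  using assms(5,6)
proof (induction n arbitrary: f g)
  case 0
  then show ?case using st by (simp add: powr_powr)
next
  case (Suc n)
  let ?R = "replicate_pmf n \<mu>"
  \<comment> \<open>\<open>F x\<close> and \<open>G y\<close> are the norms of \<open>f\<close> and
    \<open>g\<close> conditional on the first sample; by \<open>FG\<close>, averaging their powers
    gives back the full norms.\<close>
  define F where "F x = measure_pmf.expectation ?R (\<lambda>zs. f (x # map fst zs) powr (1 / s)) powr s" for x
  define G where "G y = measure_pmf.expectation ?R (\<lambda>zs. g (y # map snd zs) powr (1 / t)) powr t" for y
  have FG: "F x powr (1 / s) = measure_pmf.expectation ?R (\<lambda>zs. f (x # map fst zs) powr (1 / s))"
           "G y powr (1 / t) = measure_pmf.expectation ?R (\<lambda>zs. g (y # map snd zs) powr (1 / t))" for x y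
    using st by (simp_all add: F_def G_def powr_powr)
  have "measure_pmf.expectation (replicate_pmf (Suc n) \<mu>) (\<lambda>zs. f (map fst zs) * g (map snd zs))
      = measure_pmf.expectation \<mu> (\<lambda>z. measure_pmf.expectation ?R
           (\<lambda>zs. f (fst z # map fst zs) * g (snd z # map snd zs)))"
    by (subst expectation_replicate_pmf_Suc) (use \<mu> in simp_all)
  also have "\<dots> \<le> measure_pmf.expectation \<mu> (\<lambda>z. F (fst z) * G (snd z))"
    using Suc.prems \<mu>(2) unfolding F_def G_def
    by (intro integral_mono integrable_measure_pmf_finite Suc.IH) auto
  also have "\<dots> \<le> measure_pmf.expectation \<mu> (\<lambda>z. F (fst z) powr (1 / s)) powr s
                   * measure_pmf.expectation \<mu> (\<lambda>z. G (snd z) powr (1 / t)) powr t"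
    using \<mu>(1)[unfolded hypercontractive_def case_prod_unfold, rule_format, of F G]
    by (simp add: F_def G_def)
  also have "measure_pmf.expectation \<mu> (\<lambda>z. F (fst z) powr (1 / s))
      = measure_pmf.expectation (replicate_pmf (Suc n) \<mu>) (\<lambda>zs. f (map fst zs) powr (1 / s))"
    unfolding FG by (subst expectation_replicate_pmf_Suc) (use \<mu> in simp_all)
  also have "measure_pmf.expectation \<mu> (\<lambda>z. G (snd z) powr (1 / t))
      = measure_pmf.expectation (replicate_pmf (Suc n) \<mu>) (\<lambda>zs. g (map snd zs) powr (1 / t))"
    unfolding FG by (subst expectation_replicate_pmf_Suc) (use \<mu> in simp_all)
  finally show ?case .
qed

text \<open>Local maps preserve the inequality: test functions of the outputs are test functions of
  the samples after composition with \<open>f\<close> and \<open>g\<close>.\<close>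

lemma hypercontractive_noninteractive_output:
  assumes "hypercontractive \<mu> s t" "finite (set_pmf \<mu>)" "0 < s" "0 < t"
  shows "hypercontractive (noninteractive_output \<mu> n f g) s t"
  unfolding hypercontractive_def noninteractive_output_def
  using hypercontractive_replicate[OF assms, of "\<lambda>xs. F (f xs)" "\<lambda>ys. G (g ys)" n for F G]
  by simp

text \<open>Indicators are fixed by every power, so their norms are powers of probabilities.\<close>

lemma hypercontractive_prob_Times:
  assumes "hypercontractive W s t"
  shows "measure_pmf.prob W (A \<times> B)
      \<le> measure_pmf.prob (map_pmf fst W) A powr s * measure_pmf.prob (map_pmf snd W) B powr t"
proof -
  have ind: "(indicator S x :: real) powr c = indicator S x" for S :: "'c set" and x c
    by (simp add: indicator_def)
  have "measure_pmf.expectation W (\<lambda>(x, y). indicator A x * indicator B y)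
      \<le> measure_pmf.expectation W (\<lambda>(x, y). indicator A x powr (1 / s)) powr s
         * measure_pmf.expectation W (\<lambda>(x, y). indicator B y powr (1 / t)) powr t"
    using assms unfolding hypercontractive_def by simp
  also have "(\<lambda>(x, y). indicator A x * indicator B y :: real) = indicator (A \<times> B)"
    by (auto simp: indicator_def fun_eq_iff)
  also have "(\<lambda>(x, y). indicator A x powr (1 / s) :: real) = indicator (fst -` A)"
    by (auto simp: ind indicator_def fun_eq_iff)
  also have "(\<lambda>(x, y). indicator B y powr (1 / t) :: real) = indicator (snd -` B)"
    by (auto simp: ind indicator_def fun_eq_iff)
  finally show ?thesis by simp
qed

subsection \<open>Agreement up to Hamming distance\<close>

text \<open>The event splits into rectangles \<open>{a} \<times> N a\<close>, each of probability at
  most \<open>p a powr s * m a powr t\<close>, where \<open>m a\<close> is the mass of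
  \<open>N a\<close> under the second marginal. Weighted AM-GM makes this linear in
  \<open>p a\<close> and \<open>m a\<close>, whose sums are at most 1 and \<open>V\<close>.\<close>

lemma prob_neighbour_le:
  fixes W :: "('a \<times> 'b) pmf" and N :: "'a \<Rightarrow> 'b set"
  assumes hyp: "hypercontractive W s t"
    and st: "0 \<le> s" "s \<le> 1" "0 \<le> t" "1 \<le> s + t"
    and fin: "finite L" "finite M" and W: "set_pmf W \<subseteq> L \<times> M" and N: "\<And>a. N a \<subseteq> M"
    and V: "0 < V" "\<And>a. a \<in> L \<Longrightarrow> real (card (N a)) \<le> V"
           "\<And>b. b \<in> M \<Longrightarrow> real (card {a \<in> L. b \<in> N a}) \<le> V"
    and P: "0 \<le> P" "\<And>b. pmf (map_pmf snd W) b \<le> P"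
  shows "measure_pmf.prob W {(a, b). b \<in> N a} \<le> V powr t * P powr (s + t - 1)"
proof -
  define p where "p = pmf (map_pmf fst W)"
  define q where "q = pmf (map_pmf snd W)"
  define m where "m a = (\<Sum>b\<in>N a. q b)" for a
  have finN: "finite (N a)" for a using N fin(2) by (rule finite_subset)
  have nn: "0 \<le> p a" "0 \<le> q b" "0 \<le> m a" for a b
    by (auto simp: p_def q_def m_def intro!: sum_nonneg)
  have sum_p: "(\<Sum>a\<in>L. p a) \<le> 1"
    using fin by (simp add: p_def measure_pmf.prob_le_1 flip: measure_measure_pmf_finite)
  have sum_q: "(\<Sum>b\<in>M. q b) \<le> 1"
    using fin by (simp add: q_def measure_pmf.prob_le_1 flip: measure_measure_pmf_finite)
  have m_le: "m a \<le> V * P" if "a \<in> L" for a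
  proof -
    have "m a \<le> (\<Sum>b\<in>N a. P)" unfolding m_def q_def by (intro sum_mono P)
    also have "\<dots> \<le> V * P" using V(2)[OF that] P by (simp add: mult_right_mono)
    finally show ?thesis .
  qed
  \<comment> \<open>Double counting: each \<open>b\<close> lies in at most \<open>V\<close> of the
    sets \<open>N a\<close>.\<close>
  have "(\<Sum>a\<in>L. m a) = (\<Sum>a\<in>L. \<Sum>b\<in>M. if b \<in> N a then q b else 0)"
    unfolding m_def using fin(2) N
    by (intro sum.cong[OF refl] sum.mono_neutral_cong_left) auto
  also have "\<dots> = (\<Sum>b\<in>M. \<Sum>a\<in>L. if b \<in> N a then q b else 0)"
    by (rule sum.swap)
  also have "\<dots> = (\<Sum>b\<in>M. real (card {a \<in> L. b \<in> N a}) * q b)"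
    using fin by (intro sum.cong refl) (simp add: sum.If_cases Int_def)
  also have "\<dots> \<le> (\<Sum>b\<in>M. V * q b)"
    using V nn by (intro sum_mono mult_right_mono) auto
  also have "\<dots> \<le> V"
    using sum_q V by (simp add: mult_left_le flip: sum_distrib_left)
  finally have sum_m: "(\<Sum>a\<in>L. m a) \<le> V" .

  have "measure_pmf.prob W {(a, b). b \<in> N a} = measure_pmf.prob W (\<Union>a\<in>L. {a} \<times> N a)"
    using W by (intro measure_eq_AE) (auto simp: AE_measure_pmf_iff)
  also have "\<dots> = (\<Sum>a\<in>L. measure_pmf.prob W ({a} \<times> N a))"
    using fin by (intro measure_pmf.finite_measure_finite_Union) (auto simp: disjoint_family_on_def)
  also have "\<dots> \<le> (\<Sum>a\<in>L. V powr t * P powr (s + t - 1) * (s * p a + (1 - s) * (m a / V)))"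
  proof (rule sum_mono)
    fix a assume a: "a \<in> L"
    have "measure_pmf.prob W ({a} \<times> N a) \<le> p a powr s * m a powr t"
      using hypercontractive_prob_Times[OF hyp, of "{a}" "N a"] finN[of a]
      by (simp add: p_def m_def q_def measure_measure_pmf_finite measure_pmf_single del: measure_map_pmf)
    \<comment> \<open>Split \<open>t = (1 - s) + (s + t - 1)\<close>: the first part complements the
      exponent \<open>s\<close> for AM-GM, the second is spent on the uniform bound
      \<open>m a \<le> V * P\<close>.\<close>
    also have "\<dots> = p a powr s * (m a powr (1 - s) * m a powr (s + t - 1))"
      by (simp flip: powr_add)
    also have "\<dots> \<le> p a powr s * (m a powr (1 - s) * (V * P) powr (s + t - 1))"
      using st nn m_le[OF a] by (intro mult_left_mono powr_mono2) auto
    \<comment> \<open>Rescale to \<open>m a / V\<close>, so that these weights, like the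
      \<open>p a\<close>, have sum at most 1.\<close>
    also have "\<dots> = V powr (1 - s) * V powr (s + t - 1) * P powr (s + t - 1)
                    * (p a powr s * (m a / V) powr (1 - s))"
      using V P nn by (simp add: powr_mult powr_divide)
    also have "V powr (1 - s) * V powr (s + t - 1) = V powr t"
      by (simp flip: powr_add)
    also have "V powr t * P powr (s + t - 1) * (p a powr s * (m a / V) powr (1 - s))
        \<le> V powr t * P powr (s + t - 1) * (s * p a + (1 - s) * (m a / V))"
      using st nn V by (intro mult_left_mono weighted_am_gm) auto
    finally show "measure_pmf.prob W ({a} \<times> N a)
        \<le> V powr t * P powr (s + t - 1) * (s * p a + (1 - s) * (m a / V))" .
  qed
  also have "\<dots> = V powr t * P powr (s + t - 1) * (s * (\<Sum>a\<in>L. p a) + (1 - s) * ((\<Sum>a\<in>L. m a) / V))"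
    by (simp add: sum.distrib flip: sum_distrib_left sum_divide_distrib)
  also have "\<dots> \<le> V powr t * P powr (s + t - 1) * (s * 1 + (1 - s) * 1)"
    using st sum_p sum_m V by (intro mult_left_mono add_mono) auto
  finally show ?thesis by simp
qed

section \<open>Volume of Hamming balls\<close>

lemma hamming_dist_Cons:
  "hamming_dist (x # u) (y # v) = (if x \<noteq> y then 1 else 0) + hamming_dist u v"
proof -
  have "{i. i < length (x # u) \<and> (x # u) ! i \<noteq> (y # v) ! i}
      = (if x \<noteq> y then {0} else {}) \<union> Suc ` {i. i < length u \<and> u ! i \<noteq> v ! i}"
    by (auto simp: less_Suc_eq_0_disj)
  then show ?thesis
    by (auto simp: hamming_dist_def card_image)
qed

lemma hamming_dist_le: "hamming_dist u v \<le> length u"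
proof -
  have "{i. i < length u \<and> u ! i \<noteq> v ! i} \<subseteq> {..<length u}" by auto
  from card_mono[OF _ this] show ?thesis by (simp add: hamming_dist_def)
qed

lemma hamming_dist_commute: "length u = length v \<Longrightarrow> hamming_dist u v = hamming_dist v u"
  by (simp add: hamming_dist_def eq_commute)

lemma finite_bool_lists: "finite {v :: bool list. length v = k}"
  using finite_lists_length_eq[of "UNIV :: bool set" k] by simp

text \<open>For \<open>x\<close> in \<open>[0, 1]\<close> the summands are the law of
  \<open>u\<close> after independent bit flips with probability \<open>x\<close>. The induction
  separates whether the first bit is kept or flipped.\<close>

lemma sum_hamming_weight:
  fixes x :: real and u :: "bool list"
  shows "(\<Sum>v | length v = length u. x ^ hamming_dist u v * (1 - x) ^ (length u - hamming_dist u v)) = 1"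
proof (induction u)
  case Nil
  then show ?case by (simp add: hamming_dist_def)
next
  case (Cons c u)
  let ?w = "\<lambda>v. x ^ hamming_dist u v * (1 - x) ^ (length u - hamming_dist u v)"
  let ?L = "{v :: bool list. length v = length u}"
  have set: "{v. length v = length (c # u)} = (#) c ` ?L \<union> (#) (\<not> c) ` ?L"
  proof (intro equalityI subsetI)
    fix v :: "bool list" assume "v \<in> {v. length v = length (c # u)}"
    then obtain d v' where "v = d # v'" "length v' = length u" by (auto simp: length_Suc_conv)
    then show "v \<in> (#) c ` ?L \<union> (#) (\<not> c) ` ?L" by (cases "d = c") auto
  qed auto
  have "(\<Sum>v | length v = length (c # u). x ^ hamming_dist (c # u) v * (1 - x) ^ (length (c # u) - hamming_dist (c # u) v))
      = (\<Sum>v\<in>?L. (1 - x) * ?w v) + (\<Sum>v\<in>?L. x * ?w v)"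
    unfolding set using finite_bool_lists
    by (subst sum.union_disjoint)
       (auto simp: sum.reindex hamming_dist_Cons Suc_diff_le hamming_dist_le mult_ac intro!: sum.cong)
  also have "\<dots> = 1"
    by (simp add: Cons.IH flip: sum_distrib_left)
  finally show ?case .
qed

text \<open>For \<open>c = k\<close> the right side is the weight of a word at distance exactly
  \<open>x * k\<close> under these bit flips.\<close>

lemma binary_entropy_powr:
  assumes "0 < x" "x < 1"
  shows "2 powr (- (binary_entropy x * c)) = x powr (x * c) * (1 - x) powr ((1 - x) * c)"
proof -
  have "x powr (x * c) * (1 - x) powr ((1 - x) * c)
      = (2 powr log 2 x) powr (x * c) * (2 powr log 2 (1 - x)) powr ((1 - x) * c)"
    using assms by simp
  also have "\<dots> = 2 powr (log 2 x * (x * c) + log 2 (1 - x) * ((1 - x) * c))"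
    unfolding powr_powr powr_add ..
  finally show ?thesis
    by (simp add: binary_entropy_def algebra_simps)
qed

lemma hamming_ball_card_le:
  fixes x :: real and u :: "bool list"
  assumes "0 < x" "x < 1/2" "length u = k"
  shows "real (card {v. length v = k \<and> real (hamming_dist u v) \<le> x * real k})
           \<le> 2 powr (binary_entropy x * real k)"
proof -
  let ?B = "{v. length v = k \<and> real (hamming_dist u v) \<le> x * real k}"
  let ?w = "\<lambda>v. x ^ hamming_dist u v * (1 - x) ^ (length u - hamming_dist u v)"
  txt \<open>Flip every bit of \<open>u\<close> independently with probability \<open>x\<close>: each point of the ball has probability at
    least 2 to the power \<open>-h(x)k\<close>.\<close>
  have "real (card ?B) * 2 powr (- (binary_entropy x * real k)) = (\<Sum>v\<in>?B. 2 powr (- (binary_entropy x * real k)))"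
    by simp
  also have "\<dots> \<le> (\<Sum>v\<in>?B. ?w v)"
  proof (rule sum_mono)
    fix v assume v: "v \<in> ?B"
    define d where "d = real (hamming_dist u v)"
    have d: "d \<le> x * real k" using v by (simp add: d_def)
    have "2 powr (- (binary_entropy x * real k)) = (x / (1 - x)) powr (x * real k) * (1 - x) powr real k"
      using assms by (simp add: binary_entropy_powr powr_divide left_diff_distrib powr_diff)
    \<comment> \<open>As \<open>x < 1/2\<close>, the base \<open>x / (1 - x)\<close> is below 1: the
      weight falls with the distance and is least on the boundary of the ball.\<close>
    also have "\<dots> \<le> (x / (1 - x)) powr d * (1 - x) powr real k"
      using assms d by (intro mult_right_mono powr_mono') auto
    also have "\<dots> = x powr d * (1 - x) powr (real k - d)"
      using assms by (simp add: powr_divide powr_diff)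
    also have "\<dots> = ?w v"
      using assms hamming_dist_le[of u v] by (simp add: d_def powr_realpow flip: of_nat_diff)
    finally show "2 powr (- (binary_entropy x * real k)) \<le> ?w v" .
  qed
  also have "\<dots> \<le> (\<Sum>v | length v = length u. ?w v)"
    using assms finite_bool_lists by (intro sum_mono2) auto
  also have "\<dots> = 1" by (rule sum_hamming_weight)
  finally show ?thesis by (simp add: powr_minus field_simps)
qed

lemma binary_entropy_pos:
  assumes "0 < x" "x < 1"
  shows "0 < binary_entropy x"
proof -
  have "log 2 x < 0" "log 2 (1 - x) < 0" using assms by auto
  then have "x * log 2 x < 0" "(1 - x) * log 2 (1 - x) < 0"
    using assms by (auto simp: mult_pos_neg)
  then show ?thesis by (simp add: binary_entropy_def)
qed

lemma pmf_le_of_min_entropy: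
  assumes "c \<le> min_entropy p"
  shows "pmf p x \<le> 2 powr (- c)"
proof -
  have bdd: "bdd_above (range (pmf p))" by (auto intro!: bdd_aboveI[of _ 1] pmf_le_1)
  \<comment> \<open>The supremum must be shown positive, since \<open>2 powr log 2 S = S\<close>
    holds only for \<open>S > 0\<close>.\<close>
  obtain y where "y \<in> set_pmf p" using set_pmf_not_empty[of p] by blast
  then have "0 < pmf p y" by (simp add: pmf_positive)
  also have "\<dots> \<le> (SUP x. pmf p x)" by (rule cSUP_upper[OF _ bdd]) simp
  finally have pos: "0 < (SUP x. pmf p x)" .
  have "pmf p x \<le> (SUP x. pmf p x)" by (rule cSUP_upper[OF _ bdd]) simp
  also have "\<dots> = 2 powr (log 2 (SUP x. pmf p x))" using pos by simp
  also have "\<dots> \<le> 2 powr (- c)"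
    using assms by (intro powr_mono) (auto simp: min_entropy_def)
  finally show ?thesis .
qed

text \<open>\<open>prob_neighbour_le\<close> with Hamming balls as neighbourhoods, the entropy bound
  on their volume as \<open>V\<close> and the min-entropy bound as \<open>P\<close>.\<close>

lemma correlated_randomness_bound:
  assumes "hypercontractive W s t" "0 \<le> s" "s \<le> 1" "0 \<le> t" "1 \<le> s + t"
    and "0 < \<epsilon>'" "\<epsilon>' < 1/2" and cr: "correlated_randomness \<gamma> \<epsilon>' \<alpha> k W"
  shows "\<gamma> \<le> 2 powr (- ((\<alpha> * (s + t - 1) - binary_entropy \<epsilon>' * t) * real k))"
proof -
  define L where "L = {v :: bool list. length v = k}"
  define N where "N a = {b. length b = k \<and> real (hamming_dist a b) \<le> \<epsilon>' * real k}" for a :: "bool list"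
  have W: "set_pmf W \<subseteq> L \<times> L"
    using cr by (force simp: correlated_randomness_def L_def)
  have "\<gamma> \<le> measure_pmf.prob W {(a, b). real (hamming_dist a b) \<le> \<epsilon>' * real k}"
    using cr by (simp add: correlated_randomness_def)
  also have "\<dots> = measure_pmf.prob W {(a, b). b \<in> N a}"
    using W by (intro measure_eq_AE) (auto simp: AE_measure_pmf_iff N_def L_def)
  also have "\<dots> \<le> (2 powr (binary_entropy \<epsilon>' * real k)) powr t * (2 powr (- (\<alpha> * real k))) powr (s + t - 1)"
  proof (rule prob_neighbour_le[where L = L and M = L])
    show "finite L" "finite L" by (auto simp: L_def finite_bool_lists)
    show "real (card (N a)) \<le> 2 powr (binary_entropy \<epsilon>' * real k)" if "a \<in> L" for a
      using that assms hamming_ball_card_le[of \<epsilon>' a k] by (simp add: N_def L_def)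
    show "real (card {a \<in> L. b \<in> N a}) \<le> 2 powr (binary_entropy \<epsilon>' * real k)" if "b \<in> L" for b
    proof -
      \<comment> \<open>Hamming distance is symmetric on words of equal length, so the reverse
        neighbourhoods are balls too.\<close>
      have "{a \<in> L. b \<in> N a} = N b"
        using that by (auto simp: N_def L_def hamming_dist_commute)
      then show ?thesis
        using that assms hamming_ball_card_le[of \<epsilon>' b k] by (simp add: N_def L_def)
    qed
    show "pmf (map_pmf snd W) b \<le> 2 powr (- (\<alpha> * real k))" for b
      using cr by (intro pmf_le_of_min_entropy) (simp add: correlated_randomness_def)
    show "N a \<subseteq> L" for a by (auto simp: N_def L_def)
  qed (use assms W in auto)
  also have "\<dots> = 2 powr (- ((\<alpha> * (s + t - 1) - binary_entropy \<epsilon>' * t) * real k))"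
    by (simp add: powr_powr algebra_simps flip: powr_add)
  finally show ?thesis .
qed

subsection \<open>Optimising the exponents\<close>

text \<open>The pair is the stationary point of \<open>s + \<beta>\<^sup>2 * t\<close> on the curve
  \<open>(1 - s) * (1 - t) = \<rho>\<^sup>2 * (s * t)\<close>, which is
  \<open>(p - 1) * (q - 1) = \<rho>\<^sup>2\<close> in reciprocals. The bound
  \<open>1/2 \<le> s\<close> gives \<open>p \<le> 2\<close>.\<close>

lemma optimal_exponents:
  fixes \<rho> \<beta> s t :: real
  assumes "0 \<le> \<rho>" "\<rho> < \<beta>" "\<beta> < 1"
  defines "s \<equiv> (1 - \<rho> * \<beta>) / (1 - \<rho>\<^sup>2)" and "t \<equiv> (1 - \<rho> / \<beta>) / (1 - \<rho>\<^sup>2)"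
  shows "1/2 \<le> s" "s \<le> 1" "0 < t" "t \<le> 1" "1 \<le> s + t"
    and "(1 - s) * (1 - t) = \<rho>\<^sup>2 * (s * t)"
    and "s + \<beta>\<^sup>2 * t - 1 = (\<beta> - \<rho>)\<^sup>2 / (1 - \<rho>\<^sup>2)"
    and "0 < \<rho> \<Longrightarrow> s < 1" "0 < \<rho> \<Longrightarrow> t < 1"
proof -
  define D where "D = 1 - \<rho>\<^sup>2"
  have \<rho>2: "\<rho>\<^sup>2 < 1" using assms by (simp add: power_less_one_iff abs_square_less_1)
  then have D: "0 < D" by (simp add: D_def)
  have \<beta>: "0 < \<beta>" using assms by simp
  \<comment> \<open>The signs of \<open>1 - s\<close>, \<open>t\<close> and \<open>1 - t\<close> can
    be read off these factored forms.\<close>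
  have s: "1 - s = \<rho> * (\<beta> - \<rho>) / D" and t: "t = (\<beta> - \<rho>) / (\<beta> * D)" and t': "1 - t = \<rho> * (1 - \<rho> * \<beta>) / (\<beta> * D)"
    using D \<beta> unfolding s_def t_def D_def[symmetric]
    by (simp_all add: field_simps) (simp_all add: D_def algebra_simps power2_eq_square)
  have rb: "\<rho> * \<beta> < 1"
    using assms mult_left_le[of \<beta> \<rho>] by linarith
  \<comment> \<open>\<open>1/2 \<le> s\<close> reduces to the case \<open>\<beta> = 1\<close>, where
    it amounts to \<open>(1 - \<rho>)\<^sup>2 \<ge> 0\<close>.\<close>
  have "\<rho> * \<beta> \<le> \<rho>" using assms by (intro mult_left_le) auto
  moreover have "0 \<le> (1 - \<rho>)\<^sup>2" by simp
  ultimately have "1 - \<rho>\<^sup>2 \<le> 2 * (1 - \<rho> * \<beta>)"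
    by (simp add: power2_eq_square algebra_simps)
  then show "1/2 \<le> s" using D by (simp add: s_def D_def field_simps)
  show "0 < t" unfolding t using assms(1-3) D \<beta> by simp
  have "0 \<le> 1 - s" using assms D unfolding s by simp
  then show "s \<le> 1" by simp
  have "0 \<le> 1 - t" using assms D \<beta> rb unfolding t' by simp
  then show "t \<le> 1" by simp
  show "s < 1" if "0 < \<rho>"
  proof -
    have "0 < 1 - s" using assms D that unfolding s by simp
    then show ?thesis by simp
  qed
  show "t < 1" if "0 < \<rho>"
  proof -
    have "0 < 1 - t" using assms D \<beta> rb that unfolding t' by simp
    then show ?thesis by simp
  qed
  show eq: "(1 - s) * (1 - t) = \<rho>\<^sup>2 * (s * t)"
    unfolding s t' unfolding t s_def D_def[symmetric]
    by (simp add: power2_eq_square mult_ac)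
  \<comment> \<open>With the curve equation this gives \<open>(1 - s) * (1 - t) \<le> s * t\<close>,
    which expands to \<open>1 \<le> s + t\<close>.\<close>
  have "\<rho>\<^sup>2 * (s * t) \<le> 1 * (s * t)"
    using \<rho>2 \<open>1/2 \<le> s\<close> \<open>0 < t\<close> by (intro mult_right_mono) auto
  then have "(1 - s) * (1 - t) \<le> s * t" using eq by simp
  then show "1 \<le> s + t" by (simp add: algebra_simps)
  have "s + \<beta>\<^sup>2 * t - 1 = \<beta>\<^sup>2 * t - (1 - s)" by simp
  also have "\<dots> = (\<beta> * (\<beta> - \<rho>) - \<rho> * (\<beta> - \<rho>)) / D"
    unfolding s unfolding t using \<beta> D by (simp add: power2_eq_square field_simps)
  also have "\<dots> = (\<beta> - \<rho>)\<^sup>2 / D"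
    by (simp add: power2_eq_square algebra_simps)
  finally show "s + \<beta>\<^sup>2 * t - 1 = (\<beta> - \<rho>)\<^sup>2 / (1 - \<rho>\<^sup>2)" by (simp add: D_def)
qed

text \<open>Since \<open>1 - \<rho>\<^sup>2 = 4 * \<epsilon> * (1 - \<epsilon>)\<close>, the entropy
  hypothesis says \<open>\<rho> \<le> \<beta>\<close>, and the exponents of
  \<open>optimal_exponents\<close> apply when this is strict.\<close>

lemma agreement_probability_le:
  assumes \<epsilon>: "0 < \<epsilon>" "\<epsilon> \<le> 1/2" "0 < \<epsilon>'" "\<epsilon>' < 1/2" "0 < \<alpha>"
    and h: "binary_entropy \<epsilon>' \<le> 4 * \<epsilon> * (1 - \<epsilon>) * \<alpha>"
    and \<mu>: "is_DSBS (1 - 2 * \<epsilon>) \<mu>"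
    and solv: "noninteractively_solvable \<mu> \<gamma> \<epsilon>' \<alpha> k"
  shows "\<gamma> \<le> 2 powr (- (nu \<epsilon> \<epsilon>' \<alpha> * real k))"
proof -
  obtain n f g where cr: "correlated_randomness \<gamma> \<epsilon>' \<alpha> k (noninteractive_output \<mu> n f g)"
    using solv unfolding noninteractively_solvable_def by blast
  define \<rho> where "\<rho> = 1 - 2 * \<epsilon>"
  define \<beta> where "\<beta> = sqrt (1 - binary_entropy \<epsilon>' / \<alpha>)"
  have D: "1 - \<rho>\<^sup>2 = 4 * \<epsilon> * (1 - \<epsilon>)"
    by (simp add: \<rho>_def power2_eq_square algebra_simps)
  have \<rho>: "0 \<le> \<rho>" "\<rho> < 1" using \<epsilon> by (auto simp: \<rho>_def)
  have nu: "nu \<epsilon> \<epsilon>' \<alpha> = \<alpha> * ((\<beta> - \<rho>)\<^sup>2 / (1 - \<rho>\<^sup>2))"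
    unfolding nu_def D by (simp add: \<beta>_def \<rho>_def)
  have "0 < binary_entropy \<epsilon>'" using \<epsilon> by (intro binary_entropy_pos) auto
  then have "\<beta> < 1" using \<epsilon> by (simp add: \<beta>_def)
  have "binary_entropy \<epsilon>' / \<alpha> \<le> 1 - \<rho>\<^sup>2"
    using h \<epsilon> unfolding D by (simp add: field_simps)
  then have \<rho>2: "\<rho>\<^sup>2 \<le> 1 - binary_entropy \<epsilon>' / \<alpha>" by simp
  then have "\<rho> \<le> \<beta>" unfolding \<beta>_def by (rule real_le_rsqrt)
  have "0 \<le> 1 - binary_entropy \<epsilon>' / \<alpha>" using \<rho>2 by (rule order_trans[rotated]) simp
  then have "\<beta>\<^sup>2 = 1 - binary_entropy \<epsilon>' / \<alpha>" by (simp add: \<beta>_def)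
  then have hb: "binary_entropy \<epsilon>' = \<alpha> * (1 - \<beta>\<^sup>2)" using \<epsilon> by (simp add: field_simps)
  show ?thesis
  \<comment> \<open>In the boundary case \<open>\<nu> = 0\<close> and the claim is just
    \<open>\<gamma> \<le> 1\<close>.\<close>
  proof (cases "\<rho> = \<beta>")
    case True
    have "\<gamma> \<le> measure_pmf.prob (noninteractive_output \<mu> n f g) {(a, b). real (hamming_dist a b) \<le> \<epsilon>' * real k}"
      using cr by (simp add: correlated_randomness_def)
    also have "\<dots> \<le> 1" by (rule measure_pmf.prob_le_1)
    finally show ?thesis using True by (simp add: nu)
  next
    case False
    then have "\<rho> < \<beta>" using \<open>\<rho> \<le> \<beta>\<close> by simp
    define s t where "s = (1 - \<rho> * \<beta>) / (1 - \<rho>\<^sup>2)" and "t = (1 - \<rho> / \<beta>) / (1 - \<rho>\<^sup>2)"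
    note st = optimal_exponents[OF \<rho>(1) \<open>\<rho> < \<beta>\<close> \<open>\<beta> < 1\<close>, folded s_def t_def]
    have "hypercontractive \<mu> s t"
    \<comment> \<open>For \<open>\<rho> = 0\<close> the pair degenerates to
      \<open>s = t = 1\<close>, outside the range \<open>p, q > 1\<close> of
      \<open>hypercontractive_DSBS\<close>.\<close>
    proof (cases "\<rho> = 0")
      case True
      then show ?thesis using hypercontractive_DSBS_0 \<mu> by (simp add: s_def t_def \<rho>_def)
    next
      case False
      then have "s < 1" "t < 1" using \<rho> st by auto
      then have "hypercontractive \<mu> (1 / (1 / s)) (1 / (1 / t))"
        using \<mu> \<rho> st by (intro hypercontractive_DSBS[where \<rho> = \<rho>]) (auto simp: \<rho>_def field_simps)
      then show ?thesis by simp
    qed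
    moreover have "finite (set_pmf \<mu>)"
      using is_DSBS_set_pmf[OF \<mu>] by (rule finite_subset) simp
    ultimately have "hypercontractive (noninteractive_output \<mu> n f g) s t"
      using st by (intro hypercontractive_noninteractive_output) auto
    then have "\<gamma> \<le> 2 powr (- ((\<alpha> * (s + t - 1) - binary_entropy \<epsilon>' * t) * real k))"
      using st \<epsilon> cr by (intro correlated_randomness_bound) auto
    also have "\<alpha> * (s + t - 1) - binary_entropy \<epsilon>' * t = \<alpha> * (s + \<beta>\<^sup>2 * t - 1)"
      unfolding hb by (simp add: algebra_simps)
    also have "\<dots> = nu \<epsilon> \<epsilon>' \<alpha>" unfolding nu st(7) ..
    finally show ?thesis .
  qed
qed

section \<open>Explicit constants under slack in the entropy condition\<close>

text \<open>With \<open>D = 1 - \<rho>\<^sup>2\<close>, the slack gives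
  \<open>\<beta>\<^sup>2 - \<rho>\<^sup>2 \<ge> D * (c / (1 + c))\<close>, and
  \<open>\<beta> + \<rho> \<le> 2\<close> turns this into a lower bound on
  \<open>\<beta> - \<rho>\<close>. Squaring and dividing by \<open>D\<close> leaves one factor
  \<open>D\<close>, which is at least \<open>2 * \<epsilon>\<close> as
  \<open>\<epsilon> \<le> 1/2\<close>.\<close>

lemma nu_ge:
  assumes \<epsilon>: "0 < \<epsilon>" "\<epsilon> \<le> 1/2" "0 < \<alpha>" "0 < c"
    and nonneg: "0 \<le> binary_entropy \<epsilon>'"
    and h: "binary_entropy \<epsilon>' \<le> 4 * \<epsilon> * (1 - \<epsilon>) * \<alpha> / (1 + c)"
  shows "(c / (1 + c))\<^sup>2 / 2 * (\<epsilon> * \<alpha>) \<le> nu \<epsilon> \<epsilon>' \<alpha>"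
proof -
  define \<rho> where "\<rho> = 1 - 2 * \<epsilon>"
  define \<beta> where "\<beta> = sqrt (1 - binary_entropy \<epsilon>' / \<alpha>)"
  define D where "D = 4 * \<epsilon> * (1 - \<epsilon>)"
  have D: "1 - \<rho>\<^sup>2 = D"
    by (simp add: \<rho>_def D_def power2_eq_square algebra_simps)
  have "0 < D" using \<epsilon> by (simp add: D_def)
  have "2 * \<epsilon> * 1 \<le> 2 * \<epsilon> * (2 * (1 - \<epsilon>))" using \<epsilon> by (intro mult_left_mono) auto
  then have D2: "2 * \<epsilon> \<le> D" by (simp add: D_def algebra_simps)
  have \<rho>: "0 \<le> \<rho>" "\<rho> < 1" using \<epsilon> by (auto simp: \<rho>_def)
  have "binary_entropy \<epsilon>' / \<alpha> \<le> D / (1 + c)"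
    using h \<epsilon> by (simp add: D_def field_simps)
  also have "D / (1 + c) = D - D * (c / (1 + c))" using \<epsilon> by (simp add: field_simps)
  finally have le: "\<rho>\<^sup>2 + D * (c / (1 + c)) \<le> 1 - binary_entropy \<epsilon>' / \<alpha>" using D by linarith
  have "0 \<le> D * (c / (1 + c))" using \<open>0 < D\<close> \<epsilon> by simp
  then have "\<rho>\<^sup>2 \<le> 1 - binary_entropy \<epsilon>' / \<alpha>" using le by linarith
  then have "\<rho> \<le> \<beta>" unfolding \<beta>_def by (rule real_le_rsqrt)
  have "0 \<le> 1 - binary_entropy \<epsilon>' / \<alpha>" using \<open>\<rho>\<^sup>2 \<le> 1 - binary_entropy \<epsilon>' / \<alpha>\<close>
    by (rule order_trans[rotated]) simp
  then have \<beta>2: "\<beta>\<^sup>2 = 1 - binary_entropy \<epsilon>' / \<alpha>" by (simp add: \<beta>_def)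
  have "\<beta> \<le> 1" using \<epsilon> nonneg by (simp add: \<beta>_def)
  have "D * (c / (1 + c)) \<le> \<beta>\<^sup>2 - \<rho>\<^sup>2" using le \<beta>2 by linarith
  also have "\<dots> = (\<beta> - \<rho>) * (\<beta> + \<rho>)" by (simp add: power2_eq_square algebra_simps)
  also have "\<dots> \<le> (\<beta> - \<rho>) * 2" using \<open>\<rho> \<le> \<beta>\<close> \<open>\<beta> \<le> 1\<close> \<rho> by (intro mult_left_mono) auto
  finally have "D * (c / (1 + c)) / 2 \<le> \<beta> - \<rho>"
    by (subst pos_divide_le_eq) simp_all
  then have "(D * (c / (1 + c)) / 2)\<^sup>2 \<le> (\<beta> - \<rho>)\<^sup>2"
    using \<open>0 < D\<close> \<epsilon>(4) by (intro power_mono) auto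
  then have "(D * (c / (1 + c)) / 2)\<^sup>2 / D \<le> (\<beta> - \<rho>)\<^sup>2 / D"
    using \<open>0 < D\<close> by (intro divide_right_mono) auto
  also have "(D * (c / (1 + c)) / 2)\<^sup>2 / D = (c / (1 + c))\<^sup>2 / 4 * D"
    using \<open>0 < D\<close> \<epsilon>(4) by (simp add: power2_eq_square divide_simps) (simp add: algebra_simps)
  finally have "(c / (1 + c))\<^sup>2 / 4 * D \<le> (\<beta> - \<rho>)\<^sup>2 / D" .
  moreover have "(c / (1 + c))\<^sup>2 / 4 * (2 * \<epsilon>) \<le> (c / (1 + c))\<^sup>2 / 4 * D"
    using D2 by (intro mult_left_mono) auto
  ultimately have "(c / (1 + c))\<^sup>2 / 4 * (2 * \<epsilon>) \<le> (\<beta> - \<rho>)\<^sup>2 / D"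
    by (rule order_trans[rotated])
  then have "\<alpha> * ((c / (1 + c))\<^sup>2 / 4 * (2 * \<epsilon>)) \<le> \<alpha> * ((\<beta> - \<rho>)\<^sup>2 / D)"
    using \<epsilon>(3) by (intro mult_left_mono) simp_all
  also have "\<dots> = nu \<epsilon> \<epsilon>' \<alpha>" by (simp add: nu_def D_def \<beta>_def \<rho>_def)
  finally show ?thesis by (simp add: mult_ac)
qed

text \<open>In the second conjunct \<open>c\<close> stands for the Omega(1) slack and
  \<open>d\<close> for the constant in the exponent; \<open>d\<close> depends on \<open>c\<close>
  alone, uniformly in all other parameters.\<close>

theorem theoremC4:
  shows "(\<forall>(\<epsilon>::real) (\<epsilon>'::real) (\<alpha>::real) (\<gamma>::real) (k::nat) (\<mu> :: (real \<times> real) pmf).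
            0 < \<epsilon> \<longrightarrow> \<epsilon> \<le> 1/2 \<longrightarrow> 0 < \<epsilon>' \<longrightarrow> \<epsilon>' < 1/2 \<longrightarrow> 0 < \<alpha> \<longrightarrow> 0 < \<gamma> \<longrightarrow> 1 \<le> k \<longrightarrow>
            binary_entropy \<epsilon>' \<le> 4 * \<epsilon> * (1 - \<epsilon>) * \<alpha> \<longrightarrow>
            is_DSBS (1 - 2 * \<epsilon>) \<mu> \<longrightarrow>
            \<gamma> > 2 powr (- (nu \<epsilon> \<epsilon>' \<alpha> * real k)) \<longrightarrow>
            \<not> noninteractively_solvable \<mu> \<gamma> \<epsilon>' \<alpha> k)
       \<and> (\<forall>c>0. \<exists>d>0.
            \<forall>(\<epsilon>::real) (\<epsilon>'::real) (\<alpha>::real) (\<gamma>::real) (k::nat) (\<mu> :: (real \<times> real) pmf).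
            0 < \<epsilon> \<longrightarrow> \<epsilon> \<le> 1/2 \<longrightarrow> 0 < \<epsilon>' \<longrightarrow> \<epsilon>' < 1/2 \<longrightarrow> 0 < \<alpha> \<longrightarrow> 0 < \<gamma> \<longrightarrow> 1 \<le> k \<longrightarrow>
            binary_entropy \<epsilon>' \<le> 4 * \<epsilon> * (1 - \<epsilon>) * \<alpha> / (1 + (c::real)) \<longrightarrow>
            is_DSBS (1 - 2 * \<epsilon>) \<mu> \<longrightarrow>
            \<gamma> > 2 powr (- ((d::real) * (\<epsilon> * \<alpha> * real k))) \<longrightarrow>
            \<not> noninteractively_solvable \<mu> \<gamma> \<epsilon>' \<alpha> k)"
proof (rule conjI; (intro allI impI)?)
  fix \<epsilon> \<epsilon>' \<alpha> \<gamma> :: real and k :: nat and \<mu> :: "(real \<times> real) pmf"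
  assume "0 < \<epsilon>" "\<epsilon> \<le> 1/2" "0 < \<epsilon>'" "\<epsilon>' < 1/2" "0 < \<alpha>"
    "binary_entropy \<epsilon>' \<le> 4 * \<epsilon> * (1 - \<epsilon>) * \<alpha>" "is_DSBS (1 - 2 * \<epsilon>) \<mu>"
    "\<gamma> > 2 powr (- (nu \<epsilon> \<epsilon>' \<alpha> * real k))"
  then show "\<not> noninteractively_solvable \<mu> \<gamma> \<epsilon>' \<alpha> k"
    using agreement_probability_le[of \<epsilon> \<epsilon>' \<alpha> \<mu> \<gamma> k] by linarith
next
  fix c :: real
  assume c: "0 < c"
  show "\<exists>d>0. \<forall>(\<epsilon>::real) (\<epsilon>'::real) (\<alpha>::real) (\<gamma>::real) (k::nat) (\<mu> :: (real \<times> real) pmf).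
            0 < \<epsilon> \<longrightarrow> \<epsilon> \<le> 1/2 \<longrightarrow> 0 < \<epsilon>' \<longrightarrow> \<epsilon>' < 1/2 \<longrightarrow> 0 < \<alpha> \<longrightarrow> 0 < \<gamma> \<longrightarrow> 1 \<le> k \<longrightarrow>
            binary_entropy \<epsilon>' \<le> 4 * \<epsilon> * (1 - \<epsilon>) * \<alpha> / (1 + c) \<longrightarrow>
            is_DSBS (1 - 2 * \<epsilon>) \<mu> \<longrightarrow>
            \<gamma> > 2 powr (- (d * (\<epsilon> * \<alpha> * real k))) \<longrightarrow>
            \<not> noninteractively_solvable \<mu> \<gamma> \<epsilon>' \<alpha> k"
  \<comment> \<open>The witness is the constant of \<open>nu_ge\<close>.\<close>
  proof (intro exI[of _ "(c / (1 + c))\<^sup>2 / 2"] conjI allI impI notI)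
    show "0 < (c / (1 + c))\<^sup>2 / 2" using c by simp
    fix \<epsilon> \<epsilon>' \<alpha> \<gamma> :: real and k :: nat and \<mu> :: "(real \<times> real) pmf"
    assume \<epsilon>: "0 < \<epsilon>" "\<epsilon> \<le> 1/2" "0 < \<epsilon>'" "\<epsilon>' < 1/2" "0 < \<alpha>"
      and h: "binary_entropy \<epsilon>' \<le> 4 * \<epsilon> * (1 - \<epsilon>) * \<alpha> / (1 + c)"
      and \<mu>: "is_DSBS (1 - 2 * \<epsilon>) \<mu>"
      and \<gamma>: "\<gamma> > 2 powr (- ((c / (1 + c))\<^sup>2 / 2 * (\<epsilon> * \<alpha> * real k)))"
      and solv: "noninteractively_solvable \<mu> \<gamma> \<epsilon>' \<alpha> k"
    have "0 < binary_entropy \<epsilon>'" using \<epsilon> by (intro binary_entropy_pos) auto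
    then have "(c / (1 + c))\<^sup>2 / 2 * (\<epsilon> * \<alpha>) * real k \<le> nu \<epsilon> \<epsilon>' \<alpha> * real k"
      using \<epsilon> c h by (intro mult_right_mono nu_ge) auto
    then have "2 powr (- (nu \<epsilon> \<epsilon>' \<alpha> * real k)) \<le> 2 powr (- ((c / (1 + c))\<^sup>2 / 2 * (\<epsilon> * \<alpha> * real k)))"
      by (intro powr_mono) (auto simp: mult_ac)
    \<comment> \<open>Dividing by \<open>1 + c\<close> strengthens the entropy condition, so that of
      \<open>agreement_probability_le\<close> holds.\<close>
    moreover have "4 * \<epsilon> * (1 - \<epsilon>) * \<alpha> / (1 + c) \<le> 4 * \<epsilon> * (1 - \<epsilon>) * \<alpha> / 1"
      using \<epsilon> c by (intro divide_left_mono) auto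
    then have "binary_entropy \<epsilon>' \<le> 4 * \<epsilon> * (1 - \<epsilon>) * \<alpha>" using h by simp
    then have "\<gamma> \<le> 2 powr (- (nu \<epsilon> \<epsilon>' \<alpha> * real k))"
      using agreement_probability_le[OF \<epsilon> _ \<mu> solv] by simp
    ultimately show False using \<gamma> by linarith
  qed
qed

end
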